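(* Let $m,n\ge 1$ be integers, let $\Delta=\{\mathbf{x}_1,\dots,\mathbf{x}_n\}$ be a set of $n$ distinct points, let $\Gamma_1,\dots,\Gamma_m:\Delta\to\mathbb{R}$ be functions, and let $y_1,\dots,y_n\in\mathbb{R}$. Let $$d:=\min_{\alpha\in\mathbb{R}^m}\ \max_{1\le i\le n}\Big|y_i-\sum_{j=1}^m\alpha_j\Gamma_j(\mathbf{x}_i)\Big| .$$ Assume that the $2n\times(m+1)$ matrix whose rows are $(\Gamma_1(\mathbf{x}_i),\dots,\Gamma_m(\mathbf{x}_i),-1)$ and $(-\Gamma_1(\mathbf{x}_i),\dots,-\Gamma_m(\mathbf{x}_i),-1)$ for $1\le i\le n$ has rank $m+1$, and that there is no exact interpolation, i.e. $d>0$. Then there exist an optimal coefficient vector $\alpha\in\mathbb{R}^m$ and $m+1$ distinct points among $\mathbf{x}_1,\dots,\mathbf{x}_n$ all having the same maximum discrepancy $d$; that is, $\max_{1\le i\le n}|y_i-\sum_{j=1}^m\alpha_j\Gamma_j(\mathbf{x}_i)|=d$ and there are $m+1$ distinct indices $i\in\{1,\dots,n\}$ with $$\Big|y_i-\sum_{j=1}^m\alpha_j\Gamma_j(\mathbf{x}_i)\Big|=d .$$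
   Context: The best approximation problem is equivalent to the linear program in the $m+1$ real variables $\alpha_1,\dots,\alpha_m,z$: minimize $z$ subject to the $2n$ constraints $z\ge \sum_{j=1}^m\alpha_j\Gamma_j(\mathbf{x}_i)-y_i$ and $z\ge y_i-\sum_{j=1}^m\alpha_j\Gamma_j(\mathbf{x}_i)$, $1\le i\le n$. The (optimal, or maximum) discrepancy is the optimal value of $z$ in this program, which equals $d$. The $2n\times(m+1)$ matrix in the claim is the constraint matrix of this program. *)

theory Defs
  imports "HOL-Analysis.Analysis"
begin

text \<open>
  The index types \<open>'m\<close> and \<open>'n\<close> play the roles of \<open>{1..m}\<close> and \<open>{1..n}\<close>, so
  \<open>m = CARD('m)\<close> and \<open>n = CARD('n)\<close>; both are at least 1 because types are nonempty.
  The functions \<open>\<Gamma> j\<close> are only ever evaluated at the points \<open>x i\<close>.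
\<close>

definition discrepancy ::
  "('m::finite \<Rightarrow> 'a \<Rightarrow> real) \<Rightarrow> ('n::finite \<Rightarrow> 'a) \<Rightarrow> real^'n \<Rightarrow> real^'m \<Rightarrow> 'n \<Rightarrow> real"
  where "discrepancy \<Gamma> x y \<alpha> i = \<bar>y $ i - (\<Sum>j\<in>UNIV. \<alpha> $ j * \<Gamma> j (x i))\<bar>"

definition max_discrepancy ::
  "('m::finite \<Rightarrow> 'a \<Rightarrow> real) \<Rightarrow> ('n::finite \<Rightarrow> 'a) \<Rightarrow> real^'n \<Rightarrow> real^'m \<Rightarrow> real"
  where "max_discrepancy \<Gamma> x y \<alpha> = (MAX i. discrepancy \<Gamma> x y \<alpha> i)"

text \<open>
  The minimum over all coefficient vectors is rendered as the infimum of a nonempty set of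
  reals bounded below by 0; that it is attained is not built into the definition.
\<close>

definition optimal_discrepancy ::
  "('m::finite \<Rightarrow> 'a \<Rightarrow> real) \<Rightarrow> ('n::finite \<Rightarrow> 'a) \<Rightarrow> real^'n \<Rightarrow> real"
  where "optimal_discrepancy \<Gamma> x y = (INF \<alpha>. max_discrepancy \<Gamma> x y \<alpha>)"

text \<open>
  The \<open>2n \<times> (m + 1)\<close> matrix of the linear program. Row \<open>Inl i\<close> is
  \<open>(\<Gamma>\<^sub>1 (x i), \<dots>, \<Gamma>\<^sub>m (x i), -1)\<close> and row \<open>Inr i\<close> is
  \<open>(-\<Gamma>\<^sub>1 (x i), \<dots>, -\<Gamma>\<^sub>m (x i), -1)\<close>; column \<open>Some j\<close> belongs to the variable \<open>\<alpha> $ j\<close> and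
  column \<open>None\<close> to the variable \<open>z\<close>.
\<close>

definition constraint_matrix ::
  "('m::finite \<Rightarrow> 'a \<Rightarrow> real) \<Rightarrow> ('n::finite \<Rightarrow> 'a) \<Rightarrow> real^('m option)^('n + 'n)"
  where "constraint_matrix \<Gamma> x =
    (\<chi> r c. case c of
        None \<Rightarrow> -1
      | Some j \<Rightarrow> (case r of Inl i \<Rightarrow> \<Gamma> j (x i) | Inr i \<Rightarrow> - \<Gamma> j (x i)))"

end

theory Submission
  imports Defs
begin

text \<open>
  Among the optimal coefficient vectors take one whose set \<open>A\<close> of active points (those attaining
  \<open>d\<close>) is largest. If a nonzero direction \<open>\<beta>\<close> leaves the residuals on \<open>A\<close> unchanged, moving along it
  until a further residual reaches \<open>d\<close> enlarges \<open>A\<close>. Hence restriction to \<open>A\<close> is injective on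
  coefficient vectors. If \<open>A\<close> had at most \<open>m\<close> points, restriction would therefore also be onto,
  and one could shrink all active residuals at once, contradicting optimality.
\<close>

section \<open>The maximum norm in coordinates\<close>

lemma infnorm_le_cart_iff: "infnorm (x :: real^'n) \<le> c \<longleftrightarrow> (\<forall>i. \<bar>x $ i\<bar> \<le> c)"
proof
  assume "\<forall>i. \<bar>x $ i\<bar> \<le> c"
  then show "infnorm x \<le> c"
    unfolding infnorm_cart by (intro cSup_least) auto
qed (meson component_le_infnorm_cart order_trans)

lemma infnorm_attained_cart: "\<exists>i. infnorm (x :: real^'n) = \<bar>x $ i\<bar>"
proof -
  have *: "{\<bar>x $ i\<bar> |i. i \<in> UNIV} = range (\<lambda>i. \<bar>x $ i\<bar>)" by auto
  have "infnorm x = Max (range (\<lambda>i. \<bar>x $ i\<bar>))"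
    unfolding infnorm_cart * by (rule cSup_eq_Max) auto
  also have "\<dots> \<in> range (\<lambda>i. \<bar>x $ i\<bar>)" by (rule Max_in) auto
  finally show ?thesis by auto
qed

lemma infnorm_less_cart_iff: "infnorm (x :: real^'n) < c \<longleftrightarrow> (\<forall>i. \<bar>x $ i\<bar> < c)"
  by (metis infnorm_attained_cart component_le_infnorm_cart order_le_less_trans)

section \<open>Existence of a best approximation\<close>

text \<open>An injective \<open>G\<close> is bounded below, so the vectors doing at least as well as
  0 form a compact set, on which the continuous error attains its minimum.\<close>

lemma infnorm_approximation_attained:
  fixes G :: "real^'m \<Rightarrow> real^'n"
  assumes "linear G" "inj G"
  shows "\<exists>\<alpha>. \<forall>\<beta>. infnorm (y - G \<alpha>) \<le> infnorm (y - G \<beta>)"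
proof -
  let ?f = "\<lambda>\<alpha>. infnorm (y - G \<alpha>)"
  let ?K = "{\<alpha>. ?f \<alpha> \<le> ?f 0}"
  obtain B where B: "B > 0" "\<And>\<alpha>. B * norm \<alpha> \<le> norm (G \<alpha>)"
    using linear_inj_bounded_below_pos[OF assms] by blast
  have cont: "continuous_on UNIV ?f"
    using assms(1) by (intro continuous_intros linear_continuous_on) (simp add: linear_linear)
  have "closed ?K"
    by (intro closed_Collect_le cont continuous_on_const)
  \<comment> \<open>The lower bound for \<open>G\<close> is in the Euclidean norm; the factor
    \<open>sqrt DIM(real^'n)\<close> passes from there to \<open>infnorm\<close>.\<close>
  moreover have "norm \<alpha> \<le> sqrt DIM(real^'n) * (?f 0 + infnorm y) / B" if "\<alpha> \<in> ?K" for \<alpha>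
  proof -
    have "infnorm (G \<alpha>) \<le> ?f \<alpha> + infnorm y"
      using infnorm_triangle[of "G \<alpha> - y" y] by (simp add: infnorm_sub)
    also have "\<dots> \<le> ?f 0 + infnorm y" using that by simp
    finally have "sqrt DIM(real^'n) * infnorm (G \<alpha>) \<le> sqrt DIM(real^'n) * (?f 0 + infnorm y)"
      by (intro mult_left_mono) auto
    then have "B * norm \<alpha> \<le> sqrt DIM(real^'n) * (?f 0 + infnorm y)"
      using B(2)[of \<alpha>] norm_le_infnorm[of "G \<alpha>"] by linarith
    then show ?thesis using B(1) by (simp add: field_simps)
  qed
  then have "bounded ?K" unfolding bounded_iff by blast
  ultimately have "compact ?K" by (simp add: compact_eq_bounded_closed)
  then obtain \<alpha> where \<alpha>: "\<alpha> \<in> ?K" "\<And>\<beta>. \<beta> \<in> ?K \<Longrightarrow> ?f \<alpha> \<le> ?f \<beta>"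
    using continuous_attains_inf[of ?K ?f] continuous_on_subset[OF cont] by blast
  have "?f \<alpha> \<le> ?f \<beta>" for \<beta>
  proof (cases "\<beta> \<in> ?K")
    case False
    then show ?thesis using \<alpha>(1) by simp
  qed (use \<alpha>(2) in blast)
  then show ?thesis by blast
qed

section \<open>Interpolating on, enlarging and shrinking the active set\<close>

text \<open>A dimension count: restriction to \<open>A\<close> is injective on an m-dimensional
  space, and its target has dimension \<open>card A\<close>, at most m, so it is also onto.\<close>

lemma linear_interpolation_on_coordinates:
  fixes G :: "real^'m \<Rightarrow> real^'n"
  assumes "linear G"
    and ker: "\<And>\<beta>. (\<forall>i\<in>A. G \<beta> $ i = 0) \<Longrightarrow> \<beta> = 0"
    and card: "card A \<le> CARD('m)"
  shows "\<exists>\<beta>. \<forall>i\<in>A. G \<beta> $ i = v $ i"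
proof -
  \<comment> \<open>Vectors indexed by \<open>A\<close> are encoded as vectors that vanish off
    \<open>A\<close>; they form \<open>?W\<close>.\<close>
  define L :: "real^'m \<Rightarrow> real^'n" where "L \<beta> = (\<chi> i. if i \<in> A then G \<beta> $ i else 0)" for \<beta>
  let ?W = "{w :: real^'n. \<forall>i. i \<notin> A \<longrightarrow> w $ i = 0}"
  interpret G: linear G by fact
  have L: "linear L"
    by (rule linearI) (auto simp: L_def vec_eq_iff G.add G.scale)
  have "inj L"
    unfolding linear_injective_0[OF L] using ker by (auto simp: L_def vec_eq_iff)
  then have "dim (range L) = CARD('m)"
    using dim_image_eq[OF L, of UNIV] by (simp add: dim_UNIV)
  moreover have "dim ?W = card A"
    using dim_substandard_cart[of A, where 'a = real] by (simp add: dim_vec_eq)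
  moreover have "subspace ?W" by (auto simp: subspace_def)
  moreover have "subspace (range L)" using L by (simp add: linear_subspace_image)
  moreover have "range L \<subseteq> ?W" by (auto simp: L_def)
  ultimately have "range L = ?W"
    using card by (intro subspace_dim_equal) auto
  moreover have "(\<chi> i. if i \<in> A then v $ i else 0) \<in> ?W" by simp
  ultimately obtain \<beta> where "(\<chi> i. if i \<in> A then v $ i else 0) = L \<beta>" by blast
  then show ?thesis by (auto simp: L_def vec_eq_iff) metis
qed

text \<open>Active coordinates stay fixed because \<open>w\<close> vanishes there. The moving ones
  start below \<open>d\<close>, and the intermediate value theorem finds a time at which the largest
  of them equals \<open>d\<close>.\<close>

lemma move_until_active:
  fixes r w :: "real^'n"
  assumes r: "infnorm r = d" and "w \<noteq> 0"
    and w: "\<And>i. \<bar>r $ i\<bar> = d \<Longrightarrow> w $ i = 0"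
  shows "\<exists>t. infnorm (r - t *\<^sub>R w) = d \<and> {i. \<bar>r $ i\<bar> = d} \<subset> {i. \<bar>(r - t *\<^sub>R w) $ i\<bar> = d}"
proof -
  \<comment> \<open>Fixed coordinates are masked by 0: otherwise the active ones would keep the norm
    at \<open>d\<close> or above, and reaching \<open>d\<close> would reveal no new active
    coordinate.\<close>
  define p :: "real \<Rightarrow> real^'n" where "p t = (\<chi> i. if w $ i = 0 then 0 else r $ i - t * w $ i)" for t
  have le: "\<bar>r $ i\<bar> \<le> d" for i
    using component_le_infnorm_cart r by metis
  obtain k where k: "w $ k \<noteq> 0" using \<open>w \<noteq> 0\<close> by (auto simp: vec_eq_iff)
  have "d > 0"
    using le[of k] w[of k] k by fastforce
  \<comment> \<open>By this time coordinate \<open>k\<close> has moved by 2d from a start of size at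
    most d, so its size is at least d.\<close>
  define T where "T = 2 * d / \<bar>w $ k\<bar>"
  have "T \<ge> 0" using \<open>d > 0\<close> by (simp add: T_def)
  have "infnorm (p 0) \<le> d" using le \<open>d > 0\<close> by (auto simp: infnorm_le_cart_iff p_def)
  moreover have "d \<le> infnorm (p T)"
  proof -
    have "\<bar>T * w $ k\<bar> = 2 * d" using k \<open>d > 0\<close> by (simp add: T_def abs_mult)
    then have "d \<le> \<bar>p T $ k\<bar>" using k le[of k] by (simp add: p_def)
    then show ?thesis using component_le_infnorm_cart order_trans by blast
  qed
  moreover have "continuous_on {0..T} (\<lambda>t. infnorm (p t))"
    unfolding p_def
    apply (intro continuous_on_infnorm continuous_on_vec_lambda)
    subgoal for i by (cases "w $ i = 0") (auto intro!: continuous_intros)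
    done
  ultimately obtain t where t: "infnorm (p t) = d"
    using IVT'[of "\<lambda>t. infnorm (p t)" 0 d T] \<open>T \<ge> 0\<close> by auto
  then obtain l where l: "\<bar>p t $ l\<bar> = d" using infnorm_attained_cart by metis
  \<comment> \<open>A masked coordinate of \<open>p t\<close> is 0, hence different from
    \<open>d\<close>; so \<open>l\<close> is a moving coordinate and was not active before.\<close>
  then have wl: "w $ l \<noteq> 0" using \<open>d > 0\<close> by (auto simp: p_def)
  then have l': "\<bar>(r - t *\<^sub>R w) $ l\<bar> = d" using l by (simp add: p_def)
  have "\<bar>(r - t *\<^sub>R w) $ i\<bar> \<le> d" for i
    using le[of i] component_le_infnorm_cart[of "p t" i] t by (cases "w $ i = 0") (auto simp: p_def)
  then have "infnorm (r - t *\<^sub>R w) = d"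
    using l' component_le_infnorm_cart infnorm_le_cart_iff order_antisym by metis
  moreover have "{i. \<bar>r $ i\<bar> = d} \<subseteq> {i. \<bar>(r - t *\<^sub>R w) $ i\<bar> = d}" using w by auto
  moreover have "l \<notin> {i. \<bar>r $ i\<bar> = d}" using w wl by auto
  ultimately show ?thesis using l' by blast
qed

text \<open>For small t > 0 the active coordinates scale by 1 - t, while the inactive ones remain
  below \<open>d\<close> by continuity. Finitely many coordinates share a common t.\<close>

lemma shrink_active:
  fixes r w :: "real^'n"
  assumes r: "infnorm r = d" and "d > 0"
    and w: "\<And>i. \<bar>r $ i\<bar> = d \<Longrightarrow> w $ i = r $ i"
  shows "\<exists>t. infnorm (r - t *\<^sub>R w) < d"
proof -
  have le: "\<bar>r $ i\<bar> \<le> d" for i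
    using component_le_infnorm_cart r by metis
  have "eventually (\<lambda>t. \<bar>r $ i - t * w $ i\<bar> < d) (at_right 0)" for i
  proof (cases "\<bar>r $ i\<bar> = d")
    case True
    have "eventually (\<lambda>t::real. t \<in> {0<..<1}) (at_right 0)"
      by (rule eventually_at_right_real) simp
    then show ?thesis
    proof eventually_elim
      case (elim t)
      have "\<bar>r $ i - t * w $ i\<bar> = (1 - t) * d"
        using elim True w[OF True] by (simp add: abs_mult flip: True left_diff_distrib)
          (metis abs_mult abs_of_pos diff_gt_0_iff_gt left_diff_distrib mult_1)
      then show ?case using elim \<open>d > 0\<close> by (simp add: left_diff_distrib)
    qed
  next
    case False
    have "((\<lambda>t. \<bar>r $ i - t * w $ i\<bar>) \<longlongrightarrow> \<bar>r $ i - 0 * w $ i\<bar>) (at_right 0)"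
      by (intro tendsto_intros)
    then show ?thesis
      by (rule order_tendstoD) (use False le[of i] in auto)
  qed
  then have "eventually (\<lambda>t. \<forall>i. \<bar>r $ i - t * w $ i\<bar> < d) (at_right 0)"
    by (rule eventually_all_finite)
  then obtain t where "\<forall>i. \<bar>r $ i - t * w $ i\<bar> < d"
    using eventually_happens' trivial_limit_at_right_real by blast
  then have "infnorm (r - t *\<^sub>R w) < d" by (simp add: infnorm_less_cart_iff)
  then show ?thesis ..
qed

text \<open>The theorem for an abstract linear map: injectivity stands for the rank condition, and
  \<open>y\<close> outside the range for a positive optimum.\<close>

lemma infnorm_approximation_active_points:
  fixes G :: "real^'m \<Rightarrow> real^'n"
  assumes "linear G" "inj G"
    and no_interpolation: "\<And>\<alpha>. y \<noteq> G \<alpha>"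
  shows "\<exists>\<alpha>. (\<forall>\<beta>. infnorm (y - G \<alpha>) \<le> infnorm (y - G \<beta>)) \<and>
    CARD('m) < card {i. \<bar>(y - G \<alpha>) $ i\<bar> = infnorm (y - G \<alpha>)}"
proof -
  interpret G: linear G by fact
  obtain \<alpha>\<^sub>0 where \<alpha>\<^sub>0: "\<And>\<beta>. infnorm (y - G \<alpha>\<^sub>0) \<le> infnorm (y - G \<beta>)"
    using infnorm_approximation_attained[OF assms(1,2)] by blast
  define d where "d = infnorm (y - G \<alpha>\<^sub>0)"
  have "d > 0" using no_interpolation by (simp add: d_def infnorm_pos_lt)
  have d_le: "d \<le> infnorm (y - G \<beta>)" for \<beta> using \<alpha>\<^sub>0 by (simp add: d_def)
  let ?A = "\<lambda>\<alpha>. {i. \<bar>(y - G \<alpha>) $ i\<bar> = d}"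
  let ?opt = "\<lambda>\<alpha>. infnorm (y - G \<alpha>) = d"
  have "?opt \<alpha>\<^sub>0" by (simp add: d_def)
  \<comment> \<open>This bound on the active sets guarantees that one of maximal size
    exists.\<close>
  moreover have "\<forall>\<alpha>. ?opt \<alpha> \<longrightarrow> card (?A \<alpha>) < Suc CARD('n)"
    by (simp add: card_mono less_Suc_eq_le)
  ultimately obtain \<alpha> where \<alpha>: "?opt \<alpha>" and max: "\<And>\<beta>. ?opt \<beta> \<Longrightarrow> card (?A \<beta>) \<le> card (?A \<alpha>)"
    using ex_has_greatest_nat[of ?opt _ "\<lambda>\<alpha>. card (?A \<alpha>)"] by blast
  have step: "y - G (\<alpha> + t *\<^sub>R \<beta>) = (y - G \<alpha>) - t *\<^sub>R G \<beta>" for t \<beta>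
    by (simp add: G.add G.scale)
  have ker: "\<beta> = 0" if zero: "\<forall>i\<in>?A \<alpha>. G \<beta> $ i = 0" for \<beta>
  proof (rule ccontr)
    assume "\<beta> \<noteq> 0"
    then have "G \<beta> \<noteq> 0"
      using assms(2) linear_injective_0[OF assms(1)] by blast
    then obtain t where "infnorm (y - G \<alpha> - t *\<^sub>R G \<beta>) = d"
      "?A \<alpha> \<subset> {i. \<bar>(y - G \<alpha> - t *\<^sub>R G \<beta>) $ i\<bar> = d}"
      using move_until_active[OF \<alpha>, of "G \<beta>"] zero by blast
    then have "?opt (\<alpha> + t *\<^sub>R \<beta>)" "card (?A \<alpha>) < card (?A (\<alpha> + t *\<^sub>R \<beta>))"
      unfolding step by (auto intro: psubset_card_mono)
    then show False using max by fastforce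
  qed
  have "CARD('m) < card (?A \<alpha>)"
  proof (rule ccontr)
    assume "\<not> CARD('m) < card (?A \<alpha>)"
    then have "card (?A \<alpha>) \<le> CARD('m)" by (rule leI)
    \<comment> \<open>The residual itself is interpolated on the active set, so that moving along
      \<beta> shrinks every active residual proportionally.\<close>
    with ker obtain \<beta> where "\<forall>i\<in>?A \<alpha>. G \<beta> $ i = (y - G \<alpha>) $ i"
      using linear_interpolation_on_coordinates[OF assms(1), of "?A \<alpha>" "y - G \<alpha>"] by blast
    then obtain t where "infnorm (y - G \<alpha> - t *\<^sub>R G \<beta>) < d"
      using shrink_active[OF \<alpha> \<open>d > 0\<close>, of "G \<beta>"] by blast
    then show False using d_le[of "\<alpha> + t *\<^sub>R \<beta>"] unfolding step by simp
  qed
  then show ?thesis using \<alpha> d_le by auto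
qed

section \<open>From the constraint matrix to the linear map\<close>

text \<open>Sampling at the points turns the problem into maximum-norm approximation of
  \<open>y\<close> by the range of a linear map.\<close>

definition evaluation :: "('m::finite \<Rightarrow> 'a \<Rightarrow> real) \<Rightarrow> ('n::finite \<Rightarrow> 'a) \<Rightarrow> real^'m \<Rightarrow> real^'n"
  where "evaluation \<Gamma> x \<alpha> = (\<chi> i. \<Sum>j\<in>UNIV. \<alpha> $ j * \<Gamma> j (x i))"

lemma linear_evaluation: "linear (evaluation \<Gamma> x)"
  by (rule linearI)
    (simp_all add: evaluation_def vec_eq_iff distrib_right sum.distrib sum_distrib_left mult.assoc)

text \<open>Full column rank makes the constraint matrix injective, and a kernel vector of
  \<open>evaluation\<close>, padded by z = 0, lies in its kernel.\<close>

lemma inj_evaluation: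
  fixes \<Gamma> :: "'m::finite \<Rightarrow> 'a \<Rightarrow> real" and x :: "'n::finite \<Rightarrow> 'a"
  assumes "rank (constraint_matrix \<Gamma> x) = CARD('m) + 1"
  shows "inj (evaluation \<Gamma> x)"
proof -
  have inj: "inj ((*v) (constraint_matrix \<Gamma> x))"
    using assms by (simp flip: full_rank_injective add: card_UNIV_option)
  have "\<alpha> = 0" if "evaluation \<Gamma> x \<alpha> = 0" for \<alpha>
  proof -
    \<comment> \<open>The entry 0 at \<open>None\<close> cancels the column of -1, leaving plus or
      minus the evaluation in each row.\<close>
    define v :: "real^('m option)" where "v = (\<chi> c. case c of None \<Rightarrow> 0 | Some j \<Rightarrow> \<alpha> $ j)"
    have sum0: "(\<Sum>j\<in>UNIV. \<Gamma> j (x i) * \<alpha> $ j) = 0" for i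
      using that by (simp add: evaluation_def vec_eq_iff mult.commute)
    have "(constraint_matrix \<Gamma> x *v v) $ r = 0" for r
      using sum0 by (cases r)
        (simp_all add: matrix_vector_mult_def constraint_matrix_def v_def UNIV_option_conv
          sum.reindex sum_negf)
    then have "constraint_matrix \<Gamma> x *v v = constraint_matrix \<Gamma> x *v 0"
      by (simp add: vec_eq_iff)
    then have "v = 0" using inj by (meson injD)
    then have "v $ Some j = 0" for j by simp
    then show ?thesis by (simp add: v_def vec_eq_iff)
  qed
  then show ?thesis using linear_injective_0[OF linear_evaluation] by blast
qed

lemma discrepancy_eq: "discrepancy \<Gamma> x y \<alpha> i = \<bar>(y - evaluation \<Gamma> x \<alpha>) $ i\<bar>"
  by (simp add: discrepancy_def evaluation_def)

lemma max_discrepancy_eq: "max_discrepancy \<Gamma> x y \<alpha> = infnorm (y - evaluation \<Gamma> x \<alpha>)"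
  unfolding max_discrepancy_def discrepancy_eq
  using infnorm_attained_cart[of "y - evaluation \<Gamma> x \<alpha>"]
  by (intro Max_eqI) (auto intro: component_le_infnorm_cart simp del: vector_minus_component)

theorem theorem3p1:
  fixes x :: "'n::finite \<Rightarrow> 'a"
    and \<Gamma> :: "'m::finite \<Rightarrow> 'a \<Rightarrow> real"
    and y :: "real^'n"
  assumes distinct_points: "inj x"
    and full_rank: "rank (constraint_matrix \<Gamma> x) = CARD('m) + 1"
    and no_interpolation: "optimal_discrepancy \<Gamma> x y > 0"
  shows "\<exists>\<alpha> :: real^'m.
           max_discrepancy \<Gamma> x y \<alpha> = optimal_discrepancy \<Gamma> x y \<and>
           (\<exists>S :: 'n set. card S = CARD('m) + 1 \<and>
              (\<forall>i\<in>S. discrepancy \<Gamma> x y \<alpha> i = optimal_discrepancy \<Gamma> x y))"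
proof -
  let ?G = "evaluation \<Gamma> x"
  have opt: "optimal_discrepancy \<Gamma> x y = (INF \<alpha>. infnorm (y - ?G \<alpha>))"
    by (simp add: optimal_discrepancy_def max_discrepancy_eq)
  have bdd: "bdd_below (range (\<lambda>\<alpha>. infnorm (y - ?G \<alpha>)))"
    by (rule bdd_belowI[of _ 0]) (auto simp: infnorm_pos_le)
  \<comment> \<open>An exact fit has error 0 and would force the infimum down to at most 0.\<close>
  have "y \<noteq> ?G \<alpha>" for \<alpha>
    using cINF_lower[OF bdd, of \<alpha>] no_interpolation by (auto simp: opt infnorm_0)
  then obtain \<alpha> where \<alpha>: "\<And>\<beta>. infnorm (y - ?G \<alpha>) \<le> infnorm (y - ?G \<beta>)"
    and card: "CARD('m) < card {i. \<bar>(y - ?G \<alpha>) $ i\<bar> = infnorm (y - ?G \<alpha>)}" (is "_ < card ?A")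
    using infnorm_approximation_active_points[OF linear_evaluation inj_evaluation[OF full_rank]]
    by blast
  have "infnorm (y - ?G \<alpha>) = optimal_discrepancy \<Gamma> x y"
    unfolding opt by (intro antisym cINF_greatest cINF_lower bdd) (auto intro: \<alpha>)
  \<comment> \<open>More than m points are active; the conclusion asks for exactly m + 1 of
    them.\<close>
  moreover obtain S where "S \<subseteq> ?A" "card S = CARD('m) + 1"
    using obtain_subset_with_card_n[of "CARD('m) + 1" ?A] card by auto
  ultimately show ?thesis
    by (intro exI[of _ \<alpha>] conjI exI[of _ S]) (auto simp: max_discrepancy_eq discrepancy_eq)
qed

end
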